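(* Let $R$ be a field, let $O$ be an admissible monomial ordering on $R[x_1,\dots,x_n]$, and let $I$ be a continuous and constructive (commutative) involutive division that is Noetherian and stable. Then the commutative Involutive Basis algorithm (as described in the context), applied with $I$ and $O$ to any finite set $F$ of nonzero polynomials in $R[x_1,\dots,x_n]$, always terminates.
   Context: An admissible monomial ordering is a total order on monomials with $1<m$ for $m\ne1$ and $m_1<m_2\Rightarrow m_1m<m_2m$. $\mathrm{LM},\mathrm{LT},\mathrm{LC}$: leading monomial, term, coefficient. Involutive division $I$: assigns to each finite set $U$ of monomials and $u\in U$ a set $\mathcal M_I(u,U)\subseteq\{x_1,\dots,x_n\}$ of multiplicative variables. Write $u\mid_I w$ (over $U$) if $w=uv$ with all variables of $v$ in $\mathcal M_I(u,U)$; $\mathcal C_I(u,U)=\{w: u\mid_Iw\}$, $\mathcal C_I(U)=\bigcup_{u\in U}\mathcal C_I(u,U)$. It is required that: if $\mathcal C_I(u_1,U)\cap\mathcal C_I(u_2,U)\neq\emptyset$ then one of these cones is contained in the other; and if $V\subset U$ then $\mathcal M_I(v,U)\subseteq\mathcal M_I(v,V)$ for all $v\in V$. For a set $P$ of polynomials multiplicative variables are those of $\mathrm{LM}(p)$ over $\mathrm{LM}(P)$. For $C\subseteq P$, $\mathrm{Rem}_I(f,P,C)$ is the result of: repeatedly take the leading term $c\,w$ of the current polynomial; if $\mathrm{LM}(p)\mid_I w$ (over $\mathrm{LM}(P)$) for some $p\in C$, subtract $c\,\mathrm{LC}(p)^{-1}p\,(w/\mathrm{LM}(p))$, otherwise move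 $c\,w$ to the remainder. $\mathrm{Rem}_I(f,P)=\mathrm{Rem}_I(f,P,P)$. $\mathrm{Autoreduce}(P)$: while some $p\in P$ has $p'=\mathrm{Rem}_I(p,P,P\setminus\{p\})\neq p$, remove $p$ from $P$ and, if $p'\neq0$, insert $p'$. $P$ is autoreduced if no such $p$ exists. An autoreduced set $P$ is an Involutive Basis with respect to $I$ and $O$ if $\mathrm{Rem}_I(pt,P)=0$ for all $p\in P$ and all terms $t$. Properties. Continuous: for every $U$ and every sequence $u_1,\dots,u_m$ in $U$ such that for each $i<m$ there is $x_{j_i}\notin\mathcal M_I(u_i,U)$ with $u_{i+1}\mid_I u_ix_{j_i}$, the $u_i$ are pairwise distinct. Constructive: for every $U$, $u\in U$ and $x_i\notin\mathcal M_I(u,U)$ such that (a) $ux_i\notin\mathcal C_I(U)$ and (b) whenever $v\in U$, $x_j\notin\mathcal M_I(v,U)$, $vx_j\mid ux_i$ and $vx_j\ne ux_i$ then $vx_j\in\mathcal C_I(U)$, there is no $w\in\mathcal C_I(U)$ with $ux_i\in\mathcal C_I(w,U\cup\{w\})$. Noetherian: for every finite set $U$ of monomials there is a finite Involutive Basis $V\supseteq U$ (a set of monomials) of the monomial ideal generated by $U$, with respect to $I$ and an arbitrary admissible monomial ordering. Stable: for all distinct monomials $u,v$ with $u\mid v$, $u$ is not an involutive divisor of $v$ when multiplicative variables are taken over $\{u,v\}$. Involutive Basis algorithm. Input $F$. Set $F:=\mathrm{Autoreduce}(F)$. Repeat: let $S=\{x_if : f\in F,\ x_i\notin\mathcal M_I(\mathrm{LM}(f),\mathrm{LM}(F))\}$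 (the prolongations); process elements $s\in S$ one at a time, always choosing (and removing from $S$) an element whose leading monomial is minimal with respect to $O$, computing $s'=\mathrm{Rem}_I(s,F)$, until either some $s'\ne0$ is found or $S$ is exhausted. If some $s'\neq0$ is found, set $F:=\mathrm{Autoreduce}(F\cup\{s'\})$ and repeat; if all $s'=0$, stop and output $F$. *)

theory Defs
  imports "HOL.Modules" "HOL-Library.Poly_Mapping"
begin

section \<open>Monomials, polynomials and monomial orderings\<close>

text \<open>
  The indeterminates are the elements of a finite type \<open>'x\<close>. Monomials are
  exponent vectors, hence written additively: the monomial \<open>1\<close> is \<open>0\<close> and the product
  of two monomials is their sum. The multiplication of \<open>\<Rightarrow>\<^sub>0\<close> from
  \<open>Poly_Mapping\<close> (convolution) is the multiplication of polynomials.
\<close>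

type_synonym 'x mon = "'x \<Rightarrow>\<^sub>0 nat"
type_synonym ('x, 'k) mpoly = "('x \<Rightarrow>\<^sub>0 nat) \<Rightarrow>\<^sub>0 'k"

abbreviation indet :: "'x \<Rightarrow> 'x mon" where
  "indet x \<equiv> Poly_Mapping.single x 1"

abbreviation trm :: "'k::zero \<Rightarrow> 'x mon \<Rightarrow> ('x, 'k) mpoly" where
  "trm c m \<equiv> Poly_Mapping.single m c"

definition mon_dvd :: "'x mon \<Rightarrow> 'x mon \<Rightarrow> bool" where
  "mon_dvd u w \<longleftrightarrow> (\<exists>v. w = u + v)"

text \<open>An ordering is given by its strict part.\<close>

definition admissible :: "('x mon \<Rightarrow> 'x mon \<Rightarrow> bool) \<Rightarrow> bool" where
  "admissible lt \<longleftrightarrow> irreflp lt \<and> transp lt \<and> totalp lt \<and>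
     (\<forall>m. m \<noteq> 0 \<longrightarrow> lt 0 m) \<and>
     (\<forall>m1 m2 m. lt m1 m2 \<longrightarrow> lt (m1 + m) (m2 + m))"

text \<open>Leading monomial, coefficient and term; meaningful for nonzero polynomials only.\<close>

definition lm :: "('x mon \<Rightarrow> 'x mon \<Rightarrow> bool) \<Rightarrow> ('x, 'k::zero) mpoly \<Rightarrow> 'x mon" where
  "lm lt f = (THE m. m \<in> Poly_Mapping.keys f \<and>
                (\<forall>m'\<in>Poly_Mapping.keys f. m' \<noteq> m \<longrightarrow> lt m' m))"

definition lc :: "('x mon \<Rightarrow> 'x mon \<Rightarrow> bool) \<Rightarrow> ('x, 'k::zero) mpoly \<Rightarrow> 'k" where
  "lc lt f = Poly_Mapping.lookup f (lm lt f)"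

definition ltm :: "('x mon \<Rightarrow> 'x mon \<Rightarrow> bool) \<Rightarrow> ('x, 'k::zero) mpoly \<Rightarrow> ('x, 'k) mpoly" where
  "ltm lt f = trm (lc lt f) (lm lt f)"


section \<open>Involutive divisions\<close>

text \<open>
  \<open>M U u\<close> is the set of multiplicative variables of \<open>u\<close> over \<open>U\<close>. Only its values for
  finite \<open>U\<close> and \<open>u \<in> U\<close> are relevant.
\<close>

type_synonym 'x division = "'x mon set \<Rightarrow> 'x mon \<Rightarrow> 'x set"

definition idvd :: "'x division \<Rightarrow> 'x mon set \<Rightarrow> 'x mon \<Rightarrow> 'x mon \<Rightarrow> bool" where
  "idvd M U u w \<longleftrightarrow> (\<exists>v. w = u + v \<and> Poly_Mapping.keys v \<subseteq> M U u)"

definition cone :: "'x division \<Rightarrow> 'x mon set \<Rightarrow> 'x mon \<Rightarrow> 'x mon set" where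
  "cone M U u = {w. idvd M U u w}"

definition cones :: "'x division \<Rightarrow> 'x mon set \<Rightarrow> 'x mon set" where
  "cones M U = (\<Union>u\<in>U. cone M U u)"

definition involutive_division :: "'x division \<Rightarrow> bool" where
  "involutive_division M \<longleftrightarrow>
     (\<forall>U u1 u2. finite U \<and> u1 \<in> U \<and> u2 \<in> U \<and> cone M U u1 \<inter> cone M U u2 \<noteq> {} \<longrightarrow>
        cone M U u1 \<subseteq> cone M U u2 \<or> cone M U u2 \<subseteq> cone M U u1) \<and>
     (\<forall>U V v. finite U \<and> V \<subseteq> U \<and> v \<in> V \<longrightarrow> M U v \<subseteq> M V v)"

definition continuous_division :: "'x division \<Rightarrow> bool" where
  "continuous_division M \<longleftrightarrow>
     (\<forall>U us. finite U \<and> set us \<subseteq> U \<and>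
        (\<forall>i. Suc i < length us \<longrightarrow>
           (\<exists>x. x \<notin> M U (us ! i) \<and> idvd M U (us ! Suc i) (us ! i + indet x))) \<longrightarrow>
        distinct us)"

definition constructive_division :: "'x division \<Rightarrow> bool" where
  "constructive_division M \<longleftrightarrow>
     (\<forall>U u x. finite U \<and> u \<in> U \<and> x \<notin> M U u \<and> u + indet x \<notin> cones M U \<and>
        (\<forall>v\<in>U. \<forall>y. y \<notin> M U v \<and> mon_dvd (v + indet y) (u + indet x) \<and>
           v + indet y \<noteq> u + indet x \<longrightarrow> v + indet y \<in> cones M U) \<longrightarrow>
        \<not> (\<exists>w\<in>cones M U. u + indet x \<in> cone M (insert w U) w))"

definition stable_division :: "'x division \<Rightarrow> bool" where
  "stable_division M \<longleftrightarrow>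
     (\<forall>u v. u \<noteq> v \<and> mon_dvd u v \<longrightarrow> \<not> idvd M {u, v} u v)"


section \<open>Involutive remainder, autoreduced sets and Involutive Bases\<close>

text \<open>
  One iteration of the computation of \<open>Rem\<^sub>I(\<cdot>, P, C)\<close> on pairs (current polynomial,
  remainder so far). The involutive divisor in \<open>C\<close> need not be unique and is chosen
  nondeterministically.
\<close>

inductive rem_step ::
  "('x mon \<Rightarrow> 'x mon \<Rightarrow> bool) \<Rightarrow> 'x division \<Rightarrow> ('x, 'k::field) mpoly set \<Rightarrow> ('x, 'k) mpoly set \<Rightarrow>
   ('x, 'k) mpoly \<times> ('x, 'k) mpoly \<Rightarrow> ('x, 'k) mpoly \<times> ('x, 'k) mpoly \<Rightarrow> bool"
  for lt M P C where
  reduce: "\<lbrakk>f \<noteq> 0; p \<in> C; idvd M (lm lt ` P) (lm lt p) (lm lt f)\<rbrakk> \<Longrightarrow>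
    rem_step lt M P C (f, r) (f - trm (lc lt f * inverse (lc lt p)) (lm lt f - lm lt p) * p, r)"
| move: "\<lbrakk>f \<noteq> 0; \<not> (\<exists>p\<in>C. idvd M (lm lt ` P) (lm lt p) (lm lt f))\<rbrakk> \<Longrightarrow>
    rem_step lt M P C (f, r) (f - ltm lt f, r + ltm lt f)"

text \<open>\<open>is_rem lt M P C f r\<close>: \<open>r\<close> is a possible value of \<open>Rem\<^sub>I(f, P, C)\<close>.\<close>

definition is_rem ::
  "('x mon \<Rightarrow> 'x mon \<Rightarrow> bool) \<Rightarrow> 'x division \<Rightarrow> ('x, 'k::field) mpoly set \<Rightarrow> ('x, 'k) mpoly set \<Rightarrow>
   ('x, 'k) mpoly \<Rightarrow> ('x, 'k) mpoly \<Rightarrow> bool" where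
  "is_rem lt M P C f r \<longleftrightarrow> (rem_step lt M P C)\<^sup>*\<^sup>* (f, 0) (0, r)"

definition autoreduced ::
  "('x mon \<Rightarrow> 'x mon \<Rightarrow> bool) \<Rightarrow> 'x division \<Rightarrow> ('x, 'k::field) mpoly set \<Rightarrow> bool" where
  "autoreduced lt M P \<longleftrightarrow> \<not> (\<exists>p\<in>P. \<exists>p'. is_rem lt M P (P - {p}) p p' \<and> p' \<noteq> p)"

text \<open>
  In an autoreduced set of nonzero polynomials the involutive cones of the leading monomials
  are disjoint, so \<open>Rem\<^sub>I(\<cdot>, P)\<close> has a single value there.
\<close>

definition involutive_basis ::
  "('x mon \<Rightarrow> 'x mon \<Rightarrow> bool) \<Rightarrow> 'x division \<Rightarrow> ('x, 'k::field) mpoly set \<Rightarrow> bool" where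
  "involutive_basis lt M P \<longleftrightarrow> autoreduced lt M P \<and>
     (\<forall>p\<in>P. \<forall>c m. is_rem lt M P P (p * trm c m) 0)"

definition ideal_gen :: "'a::comm_ring_1 set \<Rightarrow> 'a set" where
  "ideal_gen = module.span (*)"

text \<open>
  The type argument is the coefficient field of the polynomial ring in which the
  monomials are considered.
\<close>

definition noetherian_division :: "'k::field itself \<Rightarrow> 'x division \<Rightarrow> bool" where
  "noetherian_division _ M \<longleftrightarrow>
     (\<forall>U lt. finite U \<and> admissible lt \<longrightarrow>
        (\<exists>V. finite V \<and> U \<subseteq> V \<and>
           ideal_gen (trm (1::'k) ` V) = ideal_gen (trm 1 ` U) \<and>
           involutive_basis lt M (trm (1::'k) ` V)))"


section \<open>The Involutive Basis algorithm as a transition system\<close>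

text \<open>
  A state records the point the computation has reached together with the current values of the
  variables; the subroutines \<open>Rem\<^sub>I\<close> and \<open>Autoreduce\<close> are executed step by step.

  \<^item> \<open>Auto P T\<close>: in \<open>Autoreduce\<close> with current set \<open>P\<close>; \<open>T\<close> consists of the elements \<open>p\<close> of \<open>P\<close> for
    which \<open>Rem\<^sub>I(p, P, P \<setminus> {p}) \<noteq> p\<close> has not yet been ruled out.
  \<^item> \<open>Auto_Rem P T p f r\<close>: computing \<open>Rem\<^sub>I(p, P, P \<setminus> {p})\<close>, with current polynomial \<open>f\<close> and
    remainder so far \<open>r\<close>.
  \<^item> \<open>Prolong F S\<close>: processing prolongations of \<open>F\<close>; those in \<open>S\<close> are still to be processed.
  \<^item> \<open>Prolong_Rem F S f r\<close>: computing \<open>Rem\<^sub>I(s, F)\<close> for an \<open>s\<close> that has been removed from \<open>S\<close>.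
  \<^item> \<open>Output F\<close>: stopped with output \<open>F\<close>.
\<close>

datatype 'p state =
    Auto "'p set" "'p set"
  | Auto_Rem "'p set" "'p set" 'p 'p 'p
  | Prolong "'p set" "'p set"
  | Prolong_Rem "'p set" "'p set" 'p 'p
  | Output "'p set"

definition prolongations ::
  "('x mon \<Rightarrow> 'x mon \<Rightarrow> bool) \<Rightarrow> 'x division \<Rightarrow> ('x, 'k::field) mpoly set \<Rightarrow> ('x, 'k) mpoly set" where
  "prolongations lt M F = {trm 1 (indet x) * f | x f. f \<in> F \<and> x \<notin> M (lm lt ` F) (lm lt f)}"

inductive ib_step ::
  "('x mon \<Rightarrow> 'x mon \<Rightarrow> bool) \<Rightarrow> 'x division \<Rightarrow>
   ('x, 'k::field) mpoly state \<Rightarrow> ('x, 'k) mpoly state \<Rightarrow> bool"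
  for lt M where
  auto_test:
    "p \<in> T \<Longrightarrow> ib_step lt M (Auto P T) (Auto_Rem P T p p 0)"
| auto_rem:
    "rem_step lt M P (P - {p}) (f, r) (f', r') \<Longrightarrow>
     ib_step lt M (Auto_Rem P T p f r) (Auto_Rem P T p f' r')"
| auto_unchanged:
    "ib_step lt M (Auto_Rem P T p 0 p) (Auto P (T - {p}))"
| auto_changed:
    "\<lbrakk>r \<noteq> p; P' = (if r = 0 then P - {p} else insert r (P - {p}))\<rbrakk> \<Longrightarrow>
     ib_step lt M (Auto_Rem P T p 0 r) (Auto P' P')"
| auto_done:
    "ib_step lt M (Auto F {}) (Prolong F (prolongations lt M F))"
| prolong_select:
    "\<lbrakk>s \<in> S; \<forall>t\<in>S. \<not> lt (lm lt t) (lm lt s)\<rbrakk> \<Longrightarrow>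
     ib_step lt M (Prolong F S) (Prolong_Rem F (S - {s}) s 0)"
| prolong_rem:
    "rem_step lt M F F (f, r) (f', r') \<Longrightarrow>
     ib_step lt M (Prolong_Rem F S f r) (Prolong_Rem F S f' r')"
| prolong_zero:
    "ib_step lt M (Prolong_Rem F S 0 0) (Prolong F S)"
| prolong_nonzero:
    "r \<noteq> 0 \<Longrightarrow> ib_step lt M (Prolong_Rem F S 0 r) (Auto (insert r F) (insert r F))"
| prolong_done:
    "ib_step lt M (Prolong F {}) (Output F)"

text \<open>
  Every run from \<open>a\<close>, whatever choices are made, is finite and can only end in a state
  satisfying \<open>final\<close>.
\<close>

definition always_terminates :: "('s \<Rightarrow> 's \<Rightarrow> bool) \<Rightarrow> ('s \<Rightarrow> bool) \<Rightarrow> 's \<Rightarrow> bool" where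
  "always_terminates step final a \<longleftrightarrow>
     \<not> (\<exists>run :: nat \<Rightarrow> 's. run 0 = a \<and> (\<forall>i. step (run i) (run (Suc i)))) \<and>
     (\<forall>b. step\<^sup>*\<^sup>* a b \<and> \<not> (\<exists>c. step b c) \<longrightarrow> final b)"

definition ib_terminates ::
  "('x mon \<Rightarrow> 'x mon \<Rightarrow> bool) \<Rightarrow> 'x division \<Rightarrow> ('x, 'k::field) mpoly set \<Rightarrow> bool" where
  "ib_terminates lt M F \<longleftrightarrow>
     always_terminates (ib_step lt M) (\<lambda>b. \<exists>G. b = Output G) (Auto F F)"

end

theory Submission
  imports Defs "HOL-Library.Multiset" "HOL-Library.Infinite_Set"
begin

text \<open>
  By stability, once the leading monomials of the current set are pairwise distinct,
  \<open>Autoreduce\<close> only changes tails, so the set \<open>U\<close> of leading monomials can only grow, by a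
  monomial \<open>w\<close> outside the involutive cones of \<open>U\<close>. By Dickson's lemma \<open>w\<close> is eventually always
  in the monomial ideal of \<open>U\<close>; then continuity and the processing order force \<open>w\<close> to be a minimal
  uncovered prolongation, and constructivity forces it into a fixed finite involutive basis
  of that ideal, which exists since the division is Noetherian. Between two such extensions,
  remainders and autoreduction terminate by multiset orderings over the well-founded monomial
  ordering.
\<close>

section \<open>Monomials and Dickson's lemma\<close>

text \<open>Indices whose value bounds all later values from below occur arbitrarily far out,
  because every tail attains a minimum. Enumerating them gives the subsequence.\<close>

lemma nat_seq_mono_subseq:
  fixes s :: "nat \<Rightarrow> nat"
  shows "\<exists>r :: nat \<Rightarrow> nat. strict_mono r \<and> mono (s \<circ> r)"
proof -
  define A where "A = {i. \<forall>j\<ge>i. s i \<le> s j}"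
  have "\<exists>i\<ge>n. i \<in> A" for n
  proof -
    obtain i where "i \<ge> n" "\<forall>j. j \<ge> n \<longrightarrow> s i \<le> s j"
      using ex_has_least_nat[of "\<lambda>i. i \<ge> n" n s] by auto
    then show ?thesis
      unfolding A_def by (intro exI[of _ i]) auto
  qed
  then have inf: "infinite A"
    unfolding infinite_nat_iff_unbounded_le by blast
  have sm: "strict_mono (enumerate A)"
    using inf by (rule strict_mono_enumerate)
  moreover have "mono (s \<circ> enumerate A)"
  proof (rule monoI)
    fix i j :: nat assume "i \<le> j"
    then have "enumerate A i \<le> enumerate A j"
      using sm by (simp add: strict_mono_less_eq)
    moreover have "enumerate A i \<in> A"
      using inf by (rule enumerate_in_set)
    ultimately show "(s \<circ> enumerate A) i \<le> (s \<circ> enumerate A) j"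
      unfolding A_def by simp
  qed
  ultimately show ?thesis by blast
qed

text \<open>Passing to a subsequence once per indeterminate makes all exponents nondecreasing
  simultaneously; then the first term of the subsequence divides the second.\<close>

lemma dickson:
  fixes m :: "nat \<Rightarrow> 'x::finite mon"
  shows "\<exists>i j. i < j \<and> mon_dvd (m i) (m j)"
proof -
  have "\<exists>r :: nat \<Rightarrow> nat. strict_mono r \<and>
      (\<forall>x\<in>X. mono (\<lambda>i. Poly_Mapping.lookup (m (r i)) x))" if "finite X" for X :: "'x set"
    using that
  proof induction
    case empty
    show ?case by (rule exI[of _ id]) (simp add: strict_mono_def)
  next
    case (insert x X)
    then obtain r :: "nat \<Rightarrow> nat" where r: "strict_mono r"
      "\<forall>x\<in>X. mono (\<lambda>i. Poly_Mapping.lookup (m (r i)) x)" by blast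
    obtain q :: "nat \<Rightarrow> nat" where q: "strict_mono q" "mono ((\<lambda>i. Poly_Mapping.lookup (m (r i)) x) \<circ> q)"
      using nat_seq_mono_subseq by blast
    have "strict_mono (r \<circ> q)"
      using r(1) q(1) unfolding strict_mono_def by simp
    moreover have "mono (\<lambda>i. Poly_Mapping.lookup (m ((r \<circ> q) i)) y)" if "y \<in> insert x X" for y
    proof (cases "y = x")
      case True
      then show ?thesis using q(2) by (simp add: o_def)
    next
      case False
      then have mr: "mono (\<lambda>i. Poly_Mapping.lookup (m (r i)) y)" using that r(2) by blast
      have "mono q" using q(1) by (rule strict_mono_mono)
      then show ?thesis using mr unfolding mono_def by simp
    qed
    ultimately show ?case by blast
  qed
  from this[of UNIV] obtain r :: "nat \<Rightarrow> nat" where r: "strict_mono r"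
    "\<forall>x. mono (\<lambda>i. Poly_Mapping.lookup (m (r i)) x)" by auto
  have "m (r 1) = m (r 0) + (m (r 1) - m (r 0))"
  proof (rule poly_mapping_eqI)
    fix x
    have "Poly_Mapping.lookup (m (r 0)) x \<le> Poly_Mapping.lookup (m (r 1)) x"
      using r(2) unfolding mono_def by simp
    then show "Poly_Mapping.lookup (m (r 1)) x = Poly_Mapping.lookup (m (r 0) + (m (r 1) - m (r 0))) x"
      by (simp add: lookup_add lookup_minus)
  qed
  moreover have "r 0 < r 1" using r(1) by (simp add: strict_mono_def)
  ultimately show ?thesis unfolding mon_dvd_def by blast
qed

lemma trm_eq_0_iff: "trm c m = 0 \<longleftrightarrow> c = 0"
  by (metis lookup_single_eq lookup_zero single_zero)

text \<open>Only one summand of the convolution survives, because addition of exponents is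
  cancellative.\<close>

lemma lookup_trm_times:
  fixes p :: "('x, 'k::field) mpoly"
  shows "Poly_Mapping.lookup (trm c m * p) (m + k) = c * Poly_Mapping.lookup p k"
proof -
  have "Poly_Mapping.lookup (trm c m * p) (m + k) =
      (\<Sum>l. (c when m = l) * (\<Sum>q. Poly_Mapping.lookup p q when m + k = l + q))"
    by (simp add: lookup_mult lookup_single)
  also have "\<dots> = (\<Sum>l. (c * (\<Sum>q. Poly_Mapping.lookup p q when m + k = l + q)) when l = m)"
    by (rule arg_cong[of _ _ Sum_any]) (auto simp: when_def)
  also have "\<dots> = c * (\<Sum>q. Poly_Mapping.lookup p q when k = q)"
    by simp
  finally show ?thesis by simp
qed

lemma keys_trm_times:
  fixes p :: "('x, 'k::field) mpoly"
  shows "Poly_Mapping.keys (trm c m * p) \<subseteq> (+) m ` Poly_Mapping.keys p"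
  using keys_mult[of "trm c m" p] by (auto split: if_splits)

lemma mon_dvd_refl: "mon_dvd u u"
  unfolding mon_dvd_def by (rule exI[of _ 0]) simp

lemma mon_dvd_trans: "mon_dvd u v \<Longrightarrow> mon_dvd v w \<Longrightarrow> mon_dvd u w"
  unfolding mon_dvd_def by (auto simp: add.assoc)

lemma mon_dvd_antisym:
  assumes "mon_dvd u v" "mon_dvd v u"
  shows "u = v"
proof -
  obtain s t where st: "v = u + s" "u = v + t" using assms unfolding mon_dvd_def by (elim exE)
  show ?thesis
  proof (rule poly_mapping_eqI)
    fix x
    show "Poly_Mapping.lookup u x = Poly_Mapping.lookup v x"
      using arg_cong[OF st(1), of "\<lambda>m. Poly_Mapping.lookup m x"]
        arg_cong[OF st(2), of "\<lambda>m. Poly_Mapping.lookup m x"] unfolding lookup_add by linarith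
  qed
qed

section \<open>Involutive divisors and cones\<close>

lemma idvd_imp_mon_dvd: "idvd M U u w \<Longrightarrow> mon_dvd u w"
  unfolding idvd_def mon_dvd_def by blast

lemma idvd_refl: "idvd M U u u"
  unfolding idvd_def by (rule exI[of _ 0]) simp

lemma cones_iff: "w \<in> cones M U \<longleftrightarrow> (\<exists>u\<in>U. idvd M U u w)"
  by (simp add: cones_def cone_def)

text \<open>Shrinking the set can only add multiplicative variables. This lets stability and
  constructivity be applied over sets other than the one at hand.\<close>

lemma idvd_antimono:
  assumes "involutive_division M" "finite U" "V \<subseteq> U" "v \<in> V" "idvd M U v w"
  shows "idvd M V v w"
proof -
  have "M U v \<subseteq> M V v"
    using assms(1)[unfolded involutive_division_def, THEN conjunct2] assms(2-4) by simp
  then show ?thesis using assms(5) unfolding idvd_def by blast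
qed

section \<open>Leading monomials\<close>

locale monomial_order =
  fixes lt :: "'x::finite mon \<Rightarrow> 'x mon \<Rightarrow> bool"
  assumes adm: "admissible lt"
begin

lemma lt_irrefl: "\<not> lt a a"
  using adm by (simp add: admissible_def irreflp_def)

lemma lt_trans: "lt a b \<Longrightarrow> lt b c \<Longrightarrow> lt a c"
  using adm by (auto simp: admissible_def elim: transpE)

lemma lt_asym: "lt a b \<Longrightarrow> \<not> lt b a"
  using lt_irrefl lt_trans by blast

lemma lt_total: "a \<noteq> b \<Longrightarrow> lt a b \<or> lt b a"
  using adm by (simp add: admissible_def totalp_on_def)

lemma lt_zero: "m \<noteq> 0 \<Longrightarrow> lt 0 m"
  using adm by (simp add: admissible_def)

lemma lt_add_left: "lt a b \<Longrightarrow> lt (m + a) (m + b)"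
  using adm by (simp add: admissible_def add.commute[of m])

lemma mon_dvd_imp_le:
  assumes "mon_dvd a b"
  shows "a = b \<or> lt a b"
proof -
  obtain v where v: "b = a + v" using assms unfolding mon_dvd_def by blast
  show ?thesis
  proof (cases "v = 0")
    case False
    then have "lt 0 v" by (rule lt_zero)
    from lt_add_left[OF this, of a] v show ?thesis by simp
  qed (simp add: v)
qed

abbreviation mon_rel :: "('x mon \<times> 'x mon) set" where
  "mon_rel \<equiv> {(a, b). lt a b}"

text \<open>By Dickson's lemma some term of an infinite descending sequence divides a later one, but
  a divisor is never larger than its multiple.\<close>

lemma wf_mon_rel: "wf mon_rel"
  unfolding wf_iff_no_infinite_down_chain
proof
  assume "\<exists>f. \<forall>i. (f (Suc i), f i) \<in> mon_rel"
  then obtain f where f: "\<And>i. lt (f (Suc i)) (f i)" by auto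
  have desc: "lt (f (Suc (i + k))) (f i)" for i k
  proof (induction k)
    case (Suc k)
    then show ?case using lt_trans[OF f[of "Suc (i + k)"]] by simp
  qed (simp add: f)
  obtain i j where ij: "i < j" "mon_dvd (f i) (f j)" using dickson by blast
  then have "lt (f j) (f i)" using desc less_imp_Suc_add by metis
  then show False
    using mon_dvd_imp_le[OF ij(2)] lt_asym lt_irrefl by metis
qed

text \<open>Supplies the existence needed for the definite description in \<open>lm\<close>.\<close>

lemma finite_max:
  assumes "finite A" "A \<noteq> {}"
  shows "\<exists>m\<in>A. \<forall>m'\<in>A. m' \<noteq> m \<longrightarrow> lt m' m"
  using assms
proof (induction rule: finite_ne_induct)
  case (insert x A)
  then obtain m where m: "m \<in> A" "\<forall>m'\<in>A. m' \<noteq> m \<longrightarrow> lt m' m" by blast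
  show ?case
  proof (cases "lt m x")
    case True
    have "lt m' x" if "m' \<in> insert x A" "m' \<noteq> x" for m'
    proof (cases "m' = m")
      case False
      then have "lt m' m" using m(2) that by simp
      then show ?thesis using True by (rule lt_trans)
    qed (simp add: True)
    then show ?thesis by (intro bexI[of _ x]) simp_all
  next
    case False
    then have "x \<noteq> m \<longrightarrow> lt x m" using lt_total by blast
    then show ?thesis using m by (intro bexI[of _ m]) auto
  qed
qed simp

lemma lm_eqI:
  assumes "m \<in> Poly_Mapping.keys f" "\<And>m'. m' \<in> Poly_Mapping.keys f \<Longrightarrow> m' \<noteq> m \<Longrightarrow> lt m' m"
  shows "lm lt f = m"
  unfolding lm_def
proof (rule the_equality)
  show "m \<in> Poly_Mapping.keys f \<and> (\<forall>m'\<in>Poly_Mapping.keys f. m' \<noteq> m \<longrightarrow> lt m' m)"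
    using assms by simp
next
  fix n assume n: "n \<in> Poly_Mapping.keys f \<and> (\<forall>m'\<in>Poly_Mapping.keys f. m' \<noteq> n \<longrightarrow> lt m' n)"
  show "n = m"
  proof (rule ccontr)
    assume "n \<noteq> m"
    then have "lt n m" "lt m n" using n assms by auto
    then show False using lt_asym by simp
  qed
qed

lemma
  assumes "f \<noteq> 0"
  shows lm_in_keys: "lm lt f \<in> Poly_Mapping.keys f"
    and lm_max: "m \<in> Poly_Mapping.keys f \<Longrightarrow> m = lm lt f \<or> lt m (lm lt f)"
proof -
  obtain n where n: "n \<in> Poly_Mapping.keys f" "\<forall>m'\<in>Poly_Mapping.keys f. m' \<noteq> n \<longrightarrow> lt m' n"
    using finite_max[of "Poly_Mapping.keys f"] assms by auto
  then have "lm lt f = n" by (intro lm_eqI) simp_all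
  with n show "lm lt f \<in> Poly_Mapping.keys f"
    "m \<in> Poly_Mapping.keys f \<Longrightarrow> m = lm lt f \<or> lt m (lm lt f)" by auto
qed

lemma lc_nonzero: "f \<noteq> 0 \<Longrightarrow> lc lt f \<noteq> 0"
  using lm_in_keys unfolding lc_def by (simp add: in_keys_iff)

lemma lm_trm: "c \<noteq> 0 \<Longrightarrow> lm lt (trm c m) = m"
  by (rule lm_eqI) auto

text \<open>The leading coefficient of the product is a product of nonzero field elements, and
  translation by \<open>m\<close> preserves the ordering.\<close>

lemma
  fixes f :: "('x, 'k::field) mpoly"
  assumes "f \<noteq> 0" "c \<noteq> 0"
  shows lm_trm_times: "lm lt (trm c m * f) = m + lm lt f"
    and trm_times_nonzero: "trm c m * f \<noteq> 0"
proof -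
  have k: "m + lm lt f \<in> Poly_Mapping.keys (trm c m * f)"
    using lc_nonzero[OF assms(1)] assms(2)
    by (simp add: in_keys_iff lookup_trm_times lc_def)
  then show "trm c m * f \<noteq> 0" by auto
  show "lm lt (trm c m * f) = m + lm lt f"
  proof (rule lm_eqI[OF k])
    fix m' assume "m' \<in> Poly_Mapping.keys (trm c m * f)" "m' \<noteq> m + lm lt f"
    then obtain n where "n \<in> Poly_Mapping.keys f" "m' = m + n" "n \<noteq> lm lt f"
      using keys_trm_times by blast
    then show "lt m' (m + lm lt f)"
      using lm_max[OF assms(1)] lt_add_left by blast
  qed
qed

section \<open>Involutive remainders\<close>

lemma keys_minus_ltm:
  fixes f :: "('x, 'k::field) mpoly"
  assumes "f \<noteq> 0" "m \<in> Poly_Mapping.keys (f - ltm lt f)"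
  shows "lt m (lm lt f)"
proof -
  have l: "Poly_Mapping.lookup f m - Poly_Mapping.lookup (ltm lt f) m \<noteq> 0"
    using assms(2) unfolding in_keys_iff lookup_minus .
  have "Poly_Mapping.lookup (ltm lt f) (lm lt f) = Poly_Mapping.lookup f (lm lt f)"
    unfolding ltm_def lc_def by simp
  then have "m \<noteq> lm lt f" using l by (metis diff_self)
  moreover from this have "m \<in> Poly_Mapping.keys f"
    using l unfolding ltm_def in_keys_iff by (simp add: lookup_single)
  ultimately show ?thesis using lm_max[OF assms(1)] by blast
qed

text \<open>The subtracted multiple of \<open>p\<close> has the same leading term as
  \<open>f\<close>, so that term cancels and only smaller monomials can remain.\<close>

lemma keys_reduce:
  fixes f p :: "('x, 'k::field) mpoly"
  assumes "f \<noteq> 0" "p \<noteq> 0" "mon_dvd (lm lt p) (lm lt f)"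
    and "m \<in> Poly_Mapping.keys (f - trm (lc lt f * inverse (lc lt p)) (lm lt f - lm lt p) * p)"
  shows "lt m (lm lt f)"
proof -
  let ?c = "lc lt f * inverse (lc lt p)" and ?d = "lm lt f - lm lt p"
  obtain v where v: "lm lt f = lm lt p + v" using assms(3) unfolding mon_dvd_def by blast
  \<comment> \<open>Subtraction of exponents is truncated in general; divisibility makes it exact
    here.\<close>
  then have d: "?d + lm lt p = lm lt f" by (simp add: add.commute)
  have "Poly_Mapping.lookup (trm ?c ?d * p) (lm lt f) = ?c * lc lt p"
    using lookup_trm_times[where c = ?c and m = ?d and p = p and k = "lm lt p"] unfolding d lc_def .
  also have "\<dots> = lc lt f" using lc_nonzero[OF assms(2)] by simp
  finally have "m \<noteq> lm lt f"
    using assms(4) by (auto simp: in_keys_iff lookup_minus lc_def)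
  moreover have "m = lm lt f \<or> lt m (lm lt f)"
  proof -
    have "m \<in> Poly_Mapping.keys f \<or> m \<in> Poly_Mapping.keys (trm ?c ?d * p)"
      using assms(4) by (auto simp: in_keys_iff lookup_minus)
    then show ?thesis
    proof
      assume m: "m \<in> Poly_Mapping.keys (trm ?c ?d * p)"
      have c: "?c \<noteq> 0" using lc_nonzero[OF assms(1)] lc_nonzero[OF assms(2)] by simp
      show ?thesis
        using lm_max[OF trm_times_nonzero[OF assms(2) c] m] unfolding lm_trm_times[OF assms(2) c] d .
    qed (use lm_max[OF assms(1)] in blast)
  qed
  ultimately show ?thesis by blast
qed

lemma rem_step_lower:
  assumes "rem_step lt M P C (f, r) (f', r')" "0 \<notin> C"
  shows "f \<noteq> 0" "\<And>m. m \<in> Poly_Mapping.keys f' \<Longrightarrow> lt m (lm lt f)"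
proof -
  have "f \<noteq> 0 \<and> (\<forall>m\<in>Poly_Mapping.keys f'. lt m (lm lt f))"
    using assms(1)
  proof cases
    case (reduce p)
    then have "p \<noteq> 0" "mon_dvd (lm lt p) (lm lt f)" using assms(2) idvd_imp_mon_dvd by auto
    then show ?thesis using reduce keys_reduce by blast
  next
    case move
    then show ?thesis using keys_minus_ltm by blast
  qed
  then show "f \<noteq> 0" "\<And>m. m \<in> Poly_Mapping.keys f' \<Longrightarrow> lt m (lm lt f)" by auto
qed

definition reducible where
  "reducible M P C w \<longleftrightarrow> (\<exists>p\<in>C. idvd M (lm lt ` P) (lm lt p) w)"

text \<open>
  The \<open>w\<close> below is the first monomial that was reduced; comparing the monomials down to \<open>w\<close> shows
  that a changed remainder is smaller in the multiset ordering.
\<close>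

definition rem_inv where
  "rem_inv M P C f0 f r \<longleftrightarrow>
     (\<forall>w\<in>Poly_Mapping.keys r. \<not> reducible M P C w) \<and>
     (\<forall>m\<in>Poly_Mapping.keys r. \<forall>m'\<in>Poly_Mapping.keys f. lt m' m) \<and>
     (f + r = f0 \<or>
      (\<exists>w\<in>Poly_Mapping.keys f0. reducible M P C w \<and> w \<notin> Poly_Mapping.keys r \<and>
         (\<forall>m'\<in>Poly_Mapping.keys f. lt m' w) \<and>
         (\<forall>m. lt w m \<longrightarrow> (m \<in> Poly_Mapping.keys r \<longleftrightarrow> m \<in> Poly_Mapping.keys f0))))"

lemma rem_inv_start: "rem_inv M P C f f 0"
  unfolding rem_inv_def by simp

text \<open>The first reduction supplies \<open>lm lt f\<close> as the witness. From then on the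
  current polynomial lies below the witness, so no later step alters the comparison above
  it.\<close>

lemma rem_inv_step:
  fixes f0 :: "('x, 'k::field) mpoly"
  assumes step: "rem_step lt M P C (f, r) (f', r')" and C: "0 \<notin> C"
    and inv: "rem_inv M P C f0 f r"
  shows "rem_inv M P C f0 f' r'"
proof -
  note low = rem_step_lower[OF step C]
  have lmk: "lm lt f \<in> Poly_Mapping.keys f" using lm_in_keys low(1) by blast
  have irr: "\<And>w. w \<in> Poly_Mapping.keys r \<Longrightarrow> \<not> reducible M P C w"
    and sep: "\<And>m m'. m \<in> Poly_Mapping.keys r \<Longrightarrow> m' \<in> Poly_Mapping.keys f \<Longrightarrow> lt m' m"
    using inv unfolding rem_inv_def by blast+
  have lmr: "lm lt f \<notin> Poly_Mapping.keys r" using sep lmk lt_irrefl by blast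
  from step show ?thesis
  proof cases
    case (reduce p)
    then have r: "r' = r" and red: "reducible M P C (lm lt f)"
      unfolding reducible_def by auto
    have "\<exists>w\<in>Poly_Mapping.keys f0. reducible M P C w \<and> w \<notin> Poly_Mapping.keys r \<and>
         (\<forall>m'\<in>Poly_Mapping.keys f'. lt m' w) \<and>
         (\<forall>m. lt w m \<longrightarrow> (m \<in> Poly_Mapping.keys r \<longleftrightarrow> m \<in> Poly_Mapping.keys f0))"
      using inv[unfolded rem_inv_def, THEN conjunct2, THEN conjunct2]
    proof
      assume f0: "f + r = f0"
      have "lm lt f \<in> Poly_Mapping.keys f0"
        using lmk lmr unfolding f0[symmetric] by (simp add: in_keys_iff lookup_add)
      moreover have "m \<in> Poly_Mapping.keys r \<longleftrightarrow> m \<in> Poly_Mapping.keys f0" if "lt (lm lt f) m" for m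
      proof -
        have "m \<notin> Poly_Mapping.keys f" using that lm_max[OF low(1)] lt_asym lt_irrefl by blast
        then show ?thesis unfolding f0[symmetric] by (simp add: in_keys_iff lookup_add)
      qed
      ultimately show ?thesis using red lmr low(2) by blast
    next
      assume "\<exists>w\<in>Poly_Mapping.keys f0. reducible M P C w \<and> w \<notin> Poly_Mapping.keys r \<and>
         (\<forall>m'\<in>Poly_Mapping.keys f. lt m' w) \<and>
         (\<forall>m. lt w m \<longrightarrow> (m \<in> Poly_Mapping.keys r \<longleftrightarrow> m \<in> Poly_Mapping.keys f0))"
      then obtain w where w: "w \<in> Poly_Mapping.keys f0" "reducible M P C w" "w \<notin> Poly_Mapping.keys r"
        "\<forall>m'\<in>Poly_Mapping.keys f. lt m' w"
        "\<forall>m. lt w m \<longrightarrow> (m \<in> Poly_Mapping.keys r \<longleftrightarrow> m \<in> Poly_Mapping.keys f0)" by blast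
      have "\<forall>m'\<in>Poly_Mapping.keys f'. lt m' w" using low(2) w(4) lmk lt_trans by blast
      then show ?thesis using w by blast
    qed
    moreover have "lt m' m" if "m \<in> Poly_Mapping.keys r" "m' \<in> Poly_Mapping.keys f'" for m m'
      using that sep lmk low(2) lt_trans by blast
    ultimately show ?thesis
      unfolding rem_inv_def r using irr by blast
  next
    case move
    then have f': "f' = f - ltm lt f" and r': "r' = r + ltm lt f"
      and red: "\<not> reducible M P C (lm lt f)"
      unfolding reducible_def by auto
    have kr: "Poly_Mapping.keys r' = insert (lm lt f) (Poly_Mapping.keys r)"
    proof (rule set_eqI)
      fix m
      show "m \<in> Poly_Mapping.keys r' \<longleftrightarrow> m \<in> insert (lm lt f) (Poly_Mapping.keys r)"
        using lmr lc_nonzero[OF low(1)]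
        by (cases "m = lm lt f") (simp_all add: r' in_keys_iff lookup_add ltm_def lookup_single)
    qed
    have "f' + r' = f0 \<or> (\<exists>w\<in>Poly_Mapping.keys f0. reducible M P C w \<and> w \<notin> Poly_Mapping.keys r' \<and>
         (\<forall>m'\<in>Poly_Mapping.keys f'. lt m' w) \<and>
         (\<forall>m. lt w m \<longrightarrow> (m \<in> Poly_Mapping.keys r' \<longleftrightarrow> m \<in> Poly_Mapping.keys f0)))"
      using inv[unfolded rem_inv_def, THEN conjunct2, THEN conjunct2]
    proof
      assume f0: "f + r = f0"
      then show ?thesis unfolding f' r' by simp
    next
      assume "\<exists>w\<in>Poly_Mapping.keys f0. reducible M P C w \<and> w \<notin> Poly_Mapping.keys r \<and>
         (\<forall>m'\<in>Poly_Mapping.keys f. lt m' w) \<and>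
         (\<forall>m. lt w m \<longrightarrow> (m \<in> Poly_Mapping.keys r \<longleftrightarrow> m \<in> Poly_Mapping.keys f0))"
      then obtain w where w: "w \<in> Poly_Mapping.keys f0" "reducible M P C w" "w \<notin> Poly_Mapping.keys r"
        "\<forall>m'\<in>Poly_Mapping.keys f. lt m' w"
        "\<forall>m. lt w m \<longrightarrow> (m \<in> Poly_Mapping.keys r \<longleftrightarrow> m \<in> Poly_Mapping.keys f0)" by blast
      have l: "lt (lm lt f) w" using w(4) lmk by blast
      then have "w \<notin> Poly_Mapping.keys r'" unfolding kr using w(3) lt_irrefl by blast
      moreover have "\<forall>m'\<in>Poly_Mapping.keys f'. lt m' w" using low(2) l lt_trans by blast
      moreover have "\<forall>m. lt w m \<longrightarrow> (m \<in> Poly_Mapping.keys r' \<longleftrightarrow> m \<in> Poly_Mapping.keys f0)"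
        unfolding kr using w(5) l lt_asym by blast
      ultimately show ?thesis using w(1,2) by blast
    qed
    moreover have "\<not> reducible M P C w" if "w \<in> Poly_Mapping.keys r'" for w
      using that irr red unfolding kr by blast
    moreover have "lt m' m" if "m \<in> Poly_Mapping.keys r'" "m' \<in> Poly_Mapping.keys f'" for m m'
      using that sep low(2) lmk lt_trans unfolding kr by blast
    ultimately show ?thesis unfolding rem_inv_def by blast
  qed
qed

lemma rem_inv_rtranclp:
  fixes f0 :: "('x, 'k::field) mpoly"
  assumes "(rem_step lt M P C)\<^sup>*\<^sup>* (f0, 0) (f, r)" "0 \<notin> C"
  shows "rem_inv M P C f0 f r"
  using assms(1)
proof (induction rule: rtranclp_induct2)
  case refl
  then show ?case by (rule rem_inv_start)
next
  case (step f r f' r')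
  then show ?case using rem_inv_step[OF _ assms(2)] by blast
qed

text \<open>With the current polynomial exhausted, the invariant becomes a dichotomy: nothing has
  changed, or a largest monomial of disagreement was lost.\<close>

lemma rem_inv_final_cases:
  fixes f0 :: "('x, 'k::field) mpoly"
  assumes "rem_inv M P C f0 0 r"
  obtains (unchanged) "r = f0" "\<And>w. w \<in> Poly_Mapping.keys f0 \<Longrightarrow> \<not> reducible M P C w"
  | (changed) w where "w \<in> Poly_Mapping.keys f0" "reducible M P C w" "w \<notin> Poly_Mapping.keys r"
      "\<And>m. lt w m \<Longrightarrow> m \<in> Poly_Mapping.keys r \<longleftrightarrow> m \<in> Poly_Mapping.keys f0"
  using assms unfolding rem_inv_def by auto

text \<open>If the remainder is 0, no monomial of \<open>f0\<close> lies above the first reduced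
  one, which is therefore the leading monomial.\<close>

lemma rem_inv_zero:
  fixes f0 :: "('x, 'k::field) mpoly"
  assumes "rem_inv M P C f0 0 0" "f0 \<noteq> 0"
  shows "reducible M P C (lm lt f0)"
  using assms(1)
proof (cases rule: rem_inv_final_cases)
  case (changed w)
  then have "lm lt f0 = w" using lm_in_keys[OF assms(2)] lm_max[OF assms(2)] by fastforce
  then show ?thesis using changed by blast
qed (use assms in simp)

text \<open>Monomials of \<open>r\<close> above the first reduced monomial come from
  \<open>f0\<close>; all others are smaller than that monomial.\<close>

lemma rem_inv_lm_le:
  fixes f0 :: "('x, 'k::field) mpoly"
  assumes "rem_inv M P C f0 0 r" "r \<noteq> 0"
  shows "lm lt r = lm lt f0 \<or> lt (lm lt r) (lm lt f0)"
  using assms(1)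
proof (cases rule: rem_inv_final_cases)
  case (changed w)
  have f0: "f0 \<noteq> 0" using changed(1) by auto
  have "lm lt r \<in> Poly_Mapping.keys r" using lm_in_keys assms(2) by blast
  moreover from this have "lm lt r \<noteq> w" using changed(3) by blast
  ultimately have "lt (lm lt r) w \<or> lm lt r \<in> Poly_Mapping.keys f0"
    using lt_total[of "lm lt r" w] changed(4)[of "lm lt r"] by blast
  then show ?thesis
  proof
    assume "lt (lm lt r) w"
    then show ?thesis using lm_max[OF f0 changed(1)] lt_trans[of "lm lt r" w] by auto
  qed (rule lm_max[OF f0])
qed (use assms in simp)

text \<open>The first reduced monomial lies strictly below an irreducible leading monomial, so the
  latter survives in the remainder.\<close>

lemma rem_inv_lm_eq:
  fixes f0 :: "('x, 'k::field) mpoly"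
  assumes "rem_inv M P C f0 0 r" "f0 \<noteq> 0" "\<not> reducible M P C (lm lt f0)"
  shows "r \<noteq> 0" "lm lt r = lm lt f0"
proof -
  have *: "lm lt f0 \<in> Poly_Mapping.keys r"
    using assms(1)
  proof (cases rule: rem_inv_final_cases)
    case unchanged
    then show ?thesis using lm_in_keys assms(2) by blast
  next
    case (changed w)
    then have "lt w (lm lt f0)" using lm_max[OF assms(2)] assms(3) by blast
    then show ?thesis using changed lm_in_keys assms(2) by blast
  qed
  then show r: "r \<noteq> 0" by auto
  show "lm lt r = lm lt f0"
    using lm_max[OF r *] rem_inv_lm_le[OF assms(1) r] lt_asym by metis
qed

section \<open>Multisets of monomials as termination measures\<close>

abbreviation keys_mset :: "('x, 'k::field) mpoly \<Rightarrow> 'x mon multiset" where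
  "keys_mset f \<equiv> mset_set (Poly_Mapping.keys f)"

text \<open>The parts above \<open>w\<close> agree, and \<open>w\<close> itself dominates everything
  else in \<open>r\<close>, whatever its size.\<close>

lemma keys_mset_lower:
  assumes "w \<in> Poly_Mapping.keys f" "w \<notin> Poly_Mapping.keys r"
    and above: "\<And>m. lt w m \<Longrightarrow> m \<in> Poly_Mapping.keys r \<longleftrightarrow> m \<in> Poly_Mapping.keys f"
  shows "(keys_mset r, keys_mset f) \<in> mult mon_rel"
proof -
  let ?A = "{m \<in> Poly_Mapping.keys f. lt w m}"
  let ?B = "{m \<in> Poly_Mapping.keys f. \<not> lt w m}" and ?B' = "{m \<in> Poly_Mapping.keys r. \<not> lt w m}"
  have split: "mset_set K = mset_set {m \<in> K. lt w m} + mset_set {m \<in> K. \<not> lt w m}"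
    if "finite K" for K
  proof -
    have "K = {m \<in> K. lt w m} \<union> {m \<in> K. \<not> lt w m}" by blast
    then show ?thesis
      using that mset_set_Union[of "{m \<in> K. lt w m}" "{m \<in> K. \<not> lt w m}"] by auto
  qed
  have "{m \<in> Poly_Mapping.keys r. lt w m} = ?A" using above by auto
  then have "keys_mset f = mset_set ?A + mset_set ?B" "keys_mset r = mset_set ?A + mset_set ?B'"
    using split[of "Poly_Mapping.keys f"] split[of "Poly_Mapping.keys r"] by simp_all
  moreover have "(mset_set ?A + mset_set ?B', mset_set ?A + mset_set ?B) \<in> mult mon_rel"
  proof (rule one_step_implies_mult)
    have w: "w \<in> ?B" using assms(1) lt_irrefl by simp
    then show "mset_set ?B \<noteq> {#}" using mset_set_empty_iff[of ?B] by auto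
    show "\<forall>k\<in>set_mset (mset_set ?B'). \<exists>j\<in>set_mset (mset_set ?B). (k, j) \<in> mon_rel"
    proof
      fix k assume "k \<in> set_mset (mset_set ?B')"
      then have "k \<in> Poly_Mapping.keys r" "\<not> lt w k" by auto
      then have "lt k w" using assms(2) lt_total[of k w] by metis
      moreover have "w \<in> set_mset (mset_set ?B)" using w by simp
      ultimately show "\<exists>j\<in>set_mset (mset_set ?B). (k, j) \<in> mon_rel" by blast
    qed
  qed
  ultimately show ?thesis by simp
qed

text \<open>A step removes the leading monomial and creates only smaller ones; this makes every
  single remainder computation finite.\<close>

lemma keys_mset_rem_step:
  assumes "rem_step lt M P C (f, r) (f', r')" "0 \<notin> C"
  shows "(keys_mset f', keys_mset f) \<in> mult mon_rel"
proof (rule keys_mset_lower)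
  note low = rem_step_lower[OF assms]
  show k: "lm lt f \<in> Poly_Mapping.keys f" using low(1) by (rule lm_in_keys)
  show "lm lt f \<notin> Poly_Mapping.keys f'" using low(2) lt_irrefl by blast
  show "m \<in> Poly_Mapping.keys f' \<longleftrightarrow> m \<in> Poly_Mapping.keys f" if "lt (lm lt f) m" for m
    using that low(2) lm_max[OF low(1)] lt_asym lt_irrefl by blast
qed

end

section \<open>Monomial completion\<close>

text \<open>The polynomials all of whose monomials are multiples of elements of \<open>U\<close>
  form an ideal containing the generators.\<close>

lemma ideal_gen_monomials:
  fixes U :: "'x mon set"
  assumes "trm (1::'k::field) m \<in> ideal_gen (trm 1 ` U)"
  shows "\<exists>u\<in>U. mon_dvd u m"
proof -
  let ?T = "{f :: ('x, 'k) mpoly. \<forall>m\<in>Poly_Mapping.keys f. \<exists>u\<in>U. mon_dvd u m}"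
  interpret module "(*) :: ('x, 'k) mpoly \<Rightarrow> _ \<Rightarrow> _"
    by unfold_locales (simp_all add: algebra_simps)
  have "subspace ?T"
  proof (rule subspaceI)
    show "0 \<in> ?T" by simp
    show "f + g \<in> ?T" if "f \<in> ?T" "g \<in> ?T" for f g
    proof -
      have "Poly_Mapping.keys (f + g) \<subseteq> Poly_Mapping.keys f \<union> Poly_Mapping.keys g"
        by (rule keys_add)
      then show ?thesis using that by blast
    qed
    show "c * f \<in> ?T" if "f \<in> ?T" for c f
    proof -
      have "\<exists>u\<in>U. mon_dvd u n" if n: "n \<in> Poly_Mapping.keys (c * f)" for n
      proof -
        obtain a b where ab: "b \<in> Poly_Mapping.keys f" "n = a + b"
          using n keys_mult[of c f] by blast
        then obtain u where "u \<in> U" "mon_dvd u b" using \<open>f \<in> ?T\<close> by blast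
        moreover have "mon_dvd b n" unfolding mon_dvd_def ab(2) by (rule exI[of _ a]) (rule add.commute)
        ultimately show ?thesis using mon_dvd_trans by (intro bexI[of _ u])
      qed
      then show ?thesis by simp
    qed
  qed
  moreover have "trm 1 ` U \<subseteq> ?T" by (auto intro: mon_dvd_refl)
  ultimately have "span (trm 1 ` U) \<subseteq> ?T" by (intro span_minimal)
  then have "trm (1::'k) m \<in> ?T" using assms unfolding ideal_gen_def by (rule subsetD)
  then show ?thesis by simp
qed

text \<open>
  Were \<open>w\<close> in no cone, every element of \<open>U\<close> dividing \<open>w\<close> would have a prolongation dividing \<open>w\<close>,
  whose involutive divisor again divides \<open>w\<close>; continuity forbids such infinite sequences.
\<close>

lemma cones_of_prolongations:
  assumes "continuous_division M" "finite U" "u \<in> U" "mon_dvd u w"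
    and prol: "\<And>v y. v \<in> U \<Longrightarrow> y \<notin> M U v \<Longrightarrow> mon_dvd (v + indet y) w \<Longrightarrow> v + indet y \<in> cones M U"
  shows "w \<in> cones M U"
proof (rule ccontr)
  assume w: "w \<notin> cones M U"
  let ?next = "\<lambda>v v'. v' \<in> U \<and> mon_dvd v' w \<and> (\<exists>x. x \<notin> M U v \<and> idvd M U v' (v + indet x))"
  have ex: "\<exists>v'. ?next v v'" if v: "v \<in> U \<and> mon_dvd v w" for v
  proof -
    obtain t where t: "w = v + t" using v unfolding mon_dvd_def by blast
    \<comment> \<open>If all variables of the cofactor were multiplicative, \<open>v\<close> would
      be an involutive divisor of \<open>w\<close>.\<close>
    have "\<not> Poly_Mapping.keys t \<subseteq> M U v"
      using w v t unfolding cones_iff idvd_def by blast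
    then obtain x where x: "x \<in> Poly_Mapping.keys t" "x \<notin> M U v" by blast
    have "t = indet x + (t - indet x)"
    proof (rule poly_mapping_eqI)
      fix y
      show "Poly_Mapping.lookup t y = Poly_Mapping.lookup (indet x + (t - indet x)) y"
        using x(1) by (cases "y = x") (simp_all add: lookup_add lookup_minus lookup_single in_keys_iff)
    qed
    then have "w = (v + indet x) + (t - indet x)" unfolding t by (simp add: add.assoc)
    then have dvd: "mon_dvd (v + indet x) w" unfolding mon_dvd_def by (rule exI)
    then have "v + indet x \<in> cones M U" using prol v x(2) by simp
    then obtain v' where v': "v' \<in> U" "idvd M U v' (v + indet x)" unfolding cones_iff by blast
    have "mon_dvd v' w" using idvd_imp_mon_dvd[OF v'(2)] dvd by (rule mon_dvd_trans)
    then show ?thesis using v' x(2) by blast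
  qed
  define g where "g v = (SOME v'. ?next v v')" for v
  have g: "?next v (g v)" if "v \<in> U \<and> mon_dvd v w" for v
    unfolding g_def using ex[OF that] by (rule someI_ex)
  define s where "s i = (g ^^ i) u" for i
  have s: "s i \<in> U \<and> mon_dvd (s i) w" for i
    by (induction i) (use g assms(3,4) in \<open>simp_all add: s_def\<close>)
  have step: "\<exists>x. x \<notin> M U (s i) \<and> idvd M U (s (Suc i)) (s i + indet x)" for i
    using g[OF s[of i]] by (simp add: s_def)
  \<comment> \<open>One entry more than \<open>U\<close> has elements, so the entries cannot be
    distinct.\<close>
  let ?us = "map s [0..<Suc (card U)]"
  have sub: "set ?us \<subseteq> U" using s by auto
  have "distinct ?us"
    using assms(1)[unfolded continuous_division_def, rule_format, of U ?us] assms(2) sub step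
    by (simp del: upt_Suc)
  then have "card (set ?us) = Suc (card U)" using distinct_card[of ?us] by simp
  then show False using card_mono[OF assms(2) sub] by simp
qed

text \<open>What the algorithm ensures about a new leading monomial: it leaves the monomial ideal of
  \<open>U\<close>, or it is a prolongation meeting exactly the premises of constructivity.\<close>

definition lead_ext :: "'x division \<Rightarrow> 'x mon set \<Rightarrow> 'x mon \<Rightarrow> bool" where
  "lead_ext M U w \<longleftrightarrow> w \<notin> cones M U \<and>
     ((\<forall>u\<in>U. \<not> mon_dvd u w) \<or>
      (\<exists>u\<in>U. \<exists>x. x \<notin> M U u \<and> w = u + indet x \<and>
         (\<forall>v\<in>U. \<forall>y. y \<notin> M U v \<and> mon_dvd (v + indet y) w \<and> v + indet y \<noteq> w \<longrightarrow>
            v + indet y \<in> cones M U)))"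

text \<open>
  An involutive basis \<open>V\<close> bounds the completion: the involutive divisor of \<open>w\<close> in \<open>V\<close> cannot be a
  proper one, as it would then lie in a cone over \<open>U\<close>, against constructivity.
\<close>

lemma lead_ext_in_basis:
  assumes M: "involutive_division M" "continuous_division M" "constructive_division M"
    and V: "finite V" "U \<subseteq> V" "\<And>v. v \<in> V \<Longrightarrow> \<exists>u\<in>U. mon_dvd u v"
      "\<And>v w. v \<in> V \<Longrightarrow> mon_dvd v w \<Longrightarrow> w \<in> cones M V"
    and ext: "lead_ext M U w" "u \<in> U" "mon_dvd u w"
  shows "w \<in> V"
proof (rule ccontr)
  assume "w \<notin> V"
  have fin: "finite U" using V(1,2) by (rule finite_subset[rotated])
  \<comment> \<open>The divisor \<open>u\<close> of \<open>w\<close> excludes the first alternative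
    of \<open>lead_ext\<close>.\<close>
  obtain z x where zx: "z \<in> U" "x \<notin> M U z" "w = z + indet x" and w: "w \<notin> cones M U"
    and prol: "\<And>v y. v \<in> U \<Longrightarrow> y \<notin> M U v \<Longrightarrow> mon_dvd (v + indet y) w \<Longrightarrow> v + indet y \<noteq> w \<Longrightarrow>
            v + indet y \<in> cones M U"
    using ext unfolding lead_ext_def by blast
  have "u \<in> V" using V(2) ext(2) by blast
  then obtain b where b: "b \<in> V" "idvd M V b w"
    using V(4)[OF _ ext(3)] unfolding cones_iff by blast
  have bw: "mon_dvd b w" "b \<noteq> w" using idvd_imp_mon_dvd[OF b(2)] \<open>w \<notin> V\<close> b(1) by auto
  obtain u' where u': "u' \<in> U" "mon_dvd u' b" using V(3) b(1) by blast
  have "b \<in> cones M U"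
  proof (rule cones_of_prolongations[OF M(2) fin u'])
    fix v y assume v: "v \<in> U" "y \<notin> M U v" "mon_dvd (v + indet y) b"
    have "v + indet y \<noteq> w" using v(3) mon_dvd_antisym[OF bw(1)] bw(2) by auto
    then show "v + indet y \<in> cones M U"
      using v(1,2) mon_dvd_trans[OF v(3) bw(1)] by (intro prol)
  qed
  \<comment> \<open>Since \<open>insert b U\<close> is contained in \<open>V\<close>, the element
    \<open>b\<close> stays an involutive divisor of \<open>w\<close>.\<close>
  moreover have "w \<in> cone M (insert b U) b"
    unfolding cone_def using idvd_antimono[OF M(1) V(1) _ _ b(2)] V(2) b(1) by simp
  moreover have "\<not> (\<exists>b\<in>cones M U. w \<in> cone M (insert b U) b)"
    using M(3)[unfolded constructive_division_def, rule_format, of U z x] fin zx w prol by simp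
  ultimately show False by blast
qed

context monomial_order
begin

text \<open>Extracts the combinatorial content of an involutive basis: a multiple of a basis
  monomial has remainder 0, so it is reducible, which places it in a cone.\<close>

lemma noetherian_basis:
  fixes M :: "'x division"
  assumes "noetherian_division TYPE('k::field) M" "finite U"
  obtains V where "finite V" "U \<subseteq> V" "\<And>v. v \<in> V \<Longrightarrow> \<exists>u\<in>U. mon_dvd u v"
      "\<And>v w. v \<in> V \<Longrightarrow> mon_dvd v w \<Longrightarrow> w \<in> cones M V"
proof -
  obtain V where V: "finite V" "U \<subseteq> V" "ideal_gen (trm (1::'k) ` V) = ideal_gen (trm 1 ` U)"
    and basis: "involutive_basis lt M (trm (1::'k) ` V)"
    using assms(1)[unfolded noetherian_division_def, rule_format, of U lt] assms(2) adm by auto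
  have "\<exists>u\<in>U. mon_dvd u v" if "v \<in> V" for v
  proof (rule ideal_gen_monomials)
    interpret module "(*) :: ('x, 'k) mpoly \<Rightarrow> _ \<Rightarrow> _"
      by unfold_locales (simp_all add: algebra_simps)
    show "trm (1::'k) v \<in> ideal_gen (trm 1 ` U)"
      unfolding V(3)[symmetric] unfolding ideal_gen_def using that by (intro span_base) simp
  qed
  moreover have "w \<in> cones M V" if vw: "v \<in> V" "mon_dvd v w" for v w
  proof -
    let ?P = "trm (1::'k) ` V"
    obtain t where t: "w = v + t" using vw(2) unfolding mon_dvd_def by blast
    have "is_rem lt M ?P ?P (trm (1::'k) v * trm 1 t) 0"
      using basis vw(1) unfolding involutive_basis_def by simp
    then have "(rem_step lt M ?P ?P)\<^sup>*\<^sup>* (trm (1::'k) w, 0) (0, 0)"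
      unfolding is_rem_def t by (simp add: mult_single)
    then have "rem_inv M ?P ?P (trm (1::'k) w) 0 0" by (rule rem_inv_rtranclp) (auto simp: trm_eq_0_iff)
    then have "reducible M ?P ?P (lm lt (trm (1::'k) w))"
      by (rule rem_inv_zero) (simp add: trm_eq_0_iff)
    moreover have "lm lt ` ?P = V" by (simp add: image_image lm_trm)
    ultimately show ?thesis unfolding reducible_def cones_iff by (simp add: lm_trm)
  qed
  ultimately show thesis by (rule that[OF V(1,2)])
qed

text \<open>The larger set is the smaller element, so well-foundedness forbids endless
  extension.\<close>

abbreviation lead_rel :: "'x division \<Rightarrow> ('x mon set \<times> 'x mon set) set" where
  "lead_rel M \<equiv> {(W, U). finite U \<and> (\<exists>w. W = insert w U \<and> lead_ext M U w)}"

text \<open>Dickson's lemma allows only finitely many extensions outside the current ideal. After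
  the last one, all sets stay inside one finite basis \<open>V\<close> while growing
  strictly.\<close>

lemma wf_lead_rel:
  fixes M :: "'x division"
  assumes M: "involutive_division M" "continuous_division M" "constructive_division M"
    "noetherian_division TYPE('k::field) M"
  shows "wf (lead_rel M)"
  unfolding wf_iff_no_infinite_down_chain
proof
  assume "\<exists>U. \<forall>i. (U (Suc i), U i) \<in> lead_rel M"
  then obtain U where "\<forall>i. \<exists>w. finite (U i) \<and> U (Suc i) = insert w (U i) \<and> lead_ext M (U i) w"
    by auto
  then obtain w where U: "\<And>i. finite (U i)" "\<And>i. U (Suc i) = insert (w i) (U i)"
    and ext: "\<And>i. lead_ext M (U i) (w i)" by metis
  have mono: "U i \<subseteq> U j" if "i \<le> j" for i j
    using U(2) by (intro lift_Suc_mono_le[OF _ that]) blast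
  have new: "w i \<notin> U i" for i
    using ext[of i] idvd_refl unfolding lead_ext_def cones_iff by blast
  define A where "A = {i. \<forall>u\<in>U i. \<not> mon_dvd u (w i)}"
  have "finite A"
  proof (rule ccontr)
    assume inf: "infinite A"
    obtain i j where ij: "i < j" "mon_dvd (w (enumerate A i)) (w (enumerate A j))"
      using dickson[of "\<lambda>i. w (enumerate A i)"] by blast
    have "Suc (enumerate A i) \<le> enumerate A j" using enumerate_mono[OF ij(1) inf] by simp
    \<comment> \<open>An earlier new monomial belongs to all later sets, so it cannot divide a later
      monomial added outside their ideal.\<close>
    then have "w (enumerate A i) \<in> U (enumerate A j)" using mono U(2) by blast
    moreover have "enumerate A j \<in> A" using inf by (rule enumerate_in_set)
    ultimately show False using ij(2) unfolding A_def by blast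
  qed
  then obtain N where N: "\<And>i. i \<ge> N \<Longrightarrow> i \<notin> A"
    unfolding finite_nat_set_iff_bounded by (metis not_less)
  obtain V where V: "finite V" "U N \<subseteq> V" "\<And>v. v \<in> V \<Longrightarrow> \<exists>u\<in>U N. mon_dvd u v"
    "\<And>v w. v \<in> V \<Longrightarrow> mon_dvd v w \<Longrightarrow> w \<in> cones M V"
    using noetherian_basis[OF M(4) U(1)] by metis
  have sub: "U (N + k) \<subseteq> V" for k
  proof (induction k)
    case (Suc k)
    have "N + k \<notin> A" using N by simp
    then obtain u where u: "u \<in> U (N + k)" "mon_dvd u (w (N + k))" unfolding A_def by blast
    have "\<exists>u\<in>U (N + k). mon_dvd u v" if "v \<in> V" for v
      using V(3)[OF that] mono[of N "N + k"] by auto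
    then have "w (N + k) \<in> V"
      using V(4) by (rule lead_ext_in_basis[OF M(1-3) V(1) Suc.IH _ _ ext u])
    then show ?case using Suc.IH U(2) by simp
  qed (simp add: V(2))
  have card: "card (U (N + k)) = card (U N) + k" for k
    by (induction k) (simp_all add: U new)
  \<comment> \<open>After \<open>Suc (card V)\<close> extensions the set would be larger than
    \<open>V\<close>.\<close>
  show False using card_mono[OF V(1) sub[of "Suc (card V)"]] unfolding card by simp
qed

section \<open>Runs of the algorithm\<close>

definition irreducible_in :: "'x division \<Rightarrow> ('x, 'k::field) mpoly set \<Rightarrow> ('x, 'k) mpoly \<Rightarrow> bool" where
  "irreducible_in M P p \<longleftrightarrow> (\<forall>w\<in>Poly_Mapping.keys p. \<not> reducible M P (P - {p}) w)"

text \<open>Every monomial is its own involutive divisor, so two elements sharing a leading monomial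
  would reduce each other.\<close>

lemma inj_on_lm_irreducible:
  assumes "0 \<notin> P" "\<And>p. p \<in> P \<Longrightarrow> irreducible_in M P p"
  shows "inj_on (lm lt) P"
proof (rule inj_onI, rule ccontr)
  fix p q assume pq: "p \<in> P" "q \<in> P" "lm lt p = lm lt q" "p \<noteq> q"
  have "p \<noteq> 0" using assms(1) pq(1) by auto
  then have "lm lt p \<in> Poly_Mapping.keys p" by (rule lm_in_keys)
  moreover have "reducible M P (P - {p}) (lm lt p)"
    unfolding reducible_def using pq idvd_refl by (intro bexI[of _ q]) auto
  ultimately show False using assms(2)[OF pq(1)] unfolding irreducible_in_def by blast
qed

text \<open>An involutive divisor over the whole set remains one over the pair of the two monomials,
  where stability excludes it.\<close>

lemma lm_irreducible:
  assumes "involutive_division M" "stable_division M" "finite P" "inj_on (lm lt) P" "p \<in> P"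
  shows "\<not> reducible M P (P - {p}) (lm lt p)"
proof
  assume "reducible M P (P - {p}) (lm lt p)"
  then obtain q where q: "q \<in> P" "q \<noteq> p" and dvd: "idvd M (lm lt ` P) (lm lt q) (lm lt p)"
    unfolding reducible_def by blast
  have "lm lt q \<noteq> lm lt p" using inj_onD[OF assms(4) _ q(1) assms(5)] q(2) by blast
  moreover have "idvd M {lm lt q, lm lt p} (lm lt q) (lm lt p)"
    by (rule idvd_antimono[OF assms(1) _ _ _ dvd]) (use assms(3,5) q(1) in auto)
  ultimately show False
    using assms(2) idvd_imp_mon_dvd[OF dvd] unfolding stable_division_def by blast
qed

section \<open>Changes made by autoreduction\<close>

abbreviation keys_mset_set :: "('x, 'k::field) mpoly set \<Rightarrow> 'x mon multiset multiset" where
  "keys_mset_set P \<equiv> image_mset keys_mset (mset_set P)"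

text \<open>One member of the multiset of supports is replaced by at most one smaller
  member.\<close>

lemma autoreduce_change:
  fixes p :: "('x, 'k::field) mpoly"
  assumes "finite P" "p \<in> P" "rem_inv M P (P - {p}) p 0 r" "r \<noteq> p"
    and P': "P' = (if r = 0 then P - {p} else insert r (P - {p}))"
  shows "(keys_mset_set P', keys_mset_set P) \<in> mult (mult mon_rel)"
proof -
  obtain w where "w \<in> Poly_Mapping.keys p" "w \<notin> Poly_Mapping.keys r"
      "\<And>m. lt w m \<Longrightarrow> m \<in> Poly_Mapping.keys r \<longleftrightarrow> m \<in> Poly_Mapping.keys p"
    using assms(3)
  proof (cases rule: rem_inv_final_cases)
    case unchanged
    then show ?thesis using assms(4) by simp
  next
    case (changed w)
    then show ?thesis using that by simp
  qed
  then have lower: "(keys_mset r, keys_mset p) \<in> mult mon_rel" by (rule keys_mset_lower)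
  \<comment> \<open>A remainder already present in the set adds no new element, just like a zero
    remainder.\<close>
  define K where "K = (if r = 0 \<or> r \<in> P - {p} then {#} else {#keys_mset r#})"
  let ?I = "keys_mset_set (P - {p})"
  have "mset_set P = add_mset p (mset_set (P - {p}))"
    using assms(1,2) by (simp add: mset_set.remove)
  then have "keys_mset_set P = ?I + {#keys_mset p#}" by simp
  moreover have "keys_mset_set P' = ?I + K"
    using assms(1) unfolding P' K_def by (auto simp: insert_absorb)
  moreover have "(?I + K, ?I + {#keys_mset p#}) \<in> mult (mult mon_rel)"
    by (rule one_step_implies_mult) (use lower in \<open>auto simp: K_def split: if_splits\<close>)
  ultimately show ?thesis by simp
qed

text \<open>Stability makes \<open>lm lt p\<close> irreducible, so \<open>p\<close> is replaced by a
  nonzero polynomial with the same leading monomial.\<close>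

lemma autoreduce_change_lm:
  fixes p :: "('x, 'k::field) mpoly"
  assumes "involutive_division M" "stable_division M" "finite P" "0 \<notin> P" "inj_on (lm lt) P"
    and "p \<in> P" "rem_inv M P (P - {p}) p 0 r"
    and P': "P' = (if r = 0 then P - {p} else insert r (P - {p}))"
  shows "inj_on (lm lt) P'" "lm lt ` P' = lm lt ` P"
proof -
  have "p \<noteq> 0" using assms(4,6) by auto
  note r = rem_inv_lm_eq[OF assms(7) this lm_irreducible[OF assms(1-3,5,6)]]
  have P: "insert p (P - {p}) = P" using assms(6) by blast
  have "lm lt ` P' = lm lt ` insert p (P - {p})" unfolding P' by (simp add: r del: insert_Diff_single)
  then show "lm lt ` P' = lm lt ` P" unfolding P .
  have "inj_on (lm lt) (P - {p})" using assms(5) by (rule inj_on_subset) blast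
  moreover have "lm lt p \<notin> lm lt ` (P - {p})"
    using inj_onD[OF assms(5) _ assms(6)] by blast
  ultimately show "inj_on (lm lt) P'" unfolding P' by (auto simp: r)
qed

section \<open>Prolongations and their remainders\<close>

lemma prolongations_props:
  assumes "0 \<notin> F" "s \<in> prolongations lt M F"
  obtains f x where "f \<in> F" "x \<notin> M (lm lt ` F) (lm lt f)" "lm lt s = lm lt f + indet x" "s \<noteq> 0"
proof -
  obtain x f where fx: "f \<in> F" "x \<notin> M (lm lt ` F) (lm lt f)" "s = trm 1 (indet x) * f"
    using assms(2) unfolding prolongations_def by blast
  have "f \<noteq> 0" using assms(1) fx(1) by auto
  then have "lm lt s = lm lt f + indet x" "s \<noteq> 0"
    using lm_trm_times[of f 1 "indet x"] trm_times_nonzero[of f 1 "indet x"] fx(3)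
    by (simp_all add: add.commute)
  then show thesis using that fx by simp
qed

lemma prolongationsI:
  assumes "0 \<notin> F" "f \<in> F" "x \<notin> M (lm lt ` F) (lm lt f)"
  obtains s where "s \<in> prolongations lt M F" "lm lt s = lm lt f + indet x"
proof -
  have "f \<noteq> 0" using assms(1,2) by auto
  then have "lm lt (trm 1 (indet x) * f) = lm lt f + indet x"
    using lm_trm_times[of f 1 "indet x"] by (simp add: add.commute)
  moreover have "trm 1 (indet x) * f \<in> prolongations lt M F"
    using assms(2,3) unfolding prolongations_def by blast
  ultimately show thesis using that by simp
qed

lemma finite_prolongations:
  assumes "finite F"
  shows "finite (prolongations lt M F)"
proof (rule finite_subset)
  show "prolongations lt M F \<subseteq> (\<lambda>(x, f). trm 1 (indet x) * f) ` (UNIV \<times> F)"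
    unfolding prolongations_def by auto
  show "finite ((\<lambda>(x, f). trm 1 (indet x) * f) ` (UNIV \<times> F))" using assms by simp
qed

lemma reducible_self_iff: "reducible M F F w \<longleftrightarrow> w \<in> cones M (lm lt ` F)"
  unfolding reducible_def cones_iff by simp

text \<open>
  A remainder that lies in the ideal of the leading monomials keeps the leading monomial of its
  prolongation: anything smaller is covered by the cones.
\<close>

lemma lead_ext_remainder:
  fixes F :: "('x, 'k::field) mpoly set"
  assumes "continuous_division M" "finite F" "0 \<notin> F" "s \<in> prolongations lt M F"
    and rem: "rem_inv M F F s 0 r" "r \<noteq> 0"
    and smaller: "\<And>t. t \<in> prolongations lt M F \<Longrightarrow> lt (lm lt t) (lm lt s) \<Longrightarrow>
        lm lt t \<in> cones M (lm lt ` F)"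
  shows "lead_ext M (lm lt ` F) (lm lt r)"
proof -
  let ?U = "lm lt ` F"
  have "lm lt r \<in> Poly_Mapping.keys r" using rem(2) by (rule lm_in_keys)
  then have new: "lm lt r \<notin> cones M ?U"
    using rem(1) unfolding rem_inv_def reducible_self_iff by blast
  have covered: "v + indet y \<in> cones M ?U"
    if v: "v \<in> ?U" "y \<notin> M ?U v" and less: "lt (v + indet y) (lm lt s)" for v y
  proof -
    obtain f where f: "f \<in> F" "v = lm lt f" using v(1) by blast
    obtain t where "t \<in> prolongations lt M F" "lm lt t = v + indet y"
      using prolongationsI[OF assms(3) f(1), of y M] v(2) f(2) by metis
    then show ?thesis using smaller less by metis
  qed
  show ?thesis
  proof (cases "\<forall>u\<in>?U. \<not> mon_dvd u (lm lt r)")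
    case True
    then show ?thesis using new unfolding lead_ext_def by simp
  next
    case False
    then obtain u where u: "u \<in> ?U" "mon_dvd u (lm lt r)" by blast
    have "lm lt r = lm lt s"
    proof (rule ccontr)
      assume "lm lt r \<noteq> lm lt s"
      then have less: "lt (lm lt r) (lm lt s)" using rem_inv_lm_le[OF rem] by simp
      have "lm lt r \<in> cones M ?U"
      proof (rule cones_of_prolongations[OF assms(1) _ u])
        show "finite ?U" using assms(2) by simp
        fix v y assume v: "v \<in> ?U" "y \<notin> M ?U v" "mon_dvd (v + indet y) (lm lt r)"
        have "lt (v + indet y) (lm lt s)"
          using mon_dvd_imp_le[OF v(3)]
        proof
          assume "lt (v + indet y) (lm lt r)"
          then show ?thesis using less by (rule lt_trans)
        qed (use less in simp)
        then show "v + indet y \<in> cones M ?U" by (rule covered[OF v(1,2)])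
      qed
      then show False using new by simp
    qed
    \<comment> \<open>A proper divisor of \<open>lm lt s\<close> is smaller in the ordering, so the
      minimal choice of \<open>s\<close> has already covered it.\<close>
    moreover have "v + indet y \<in> cones M ?U"
      if "v \<in> ?U" "y \<notin> M ?U v" "mon_dvd (v + indet y) (lm lt s)" "v + indet y \<noteq> lm lt s" for v y
      using that mon_dvd_imp_le[OF that(3)] by (intro covered) auto
    moreover obtain f x where "f \<in> F" "x \<notin> M ?U (lm lt f)" "lm lt s = lm lt f + indet x"
      by (rule prolongations_props[OF assms(3,4)])
    ultimately show ?thesis using new unfolding lead_ext_def by auto
  qed
qed

text \<open>Elements outside \<open>T\<close> have passed their test, and prolongations outside
  \<open>S\<close> have leading monomials in the cones. The state no longer stores the prolongation
  being reduced, hence the existential \<open>s\<close>; the last clause for it records that it was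
  chosen minimal.\<close>

fun state_inv :: "'x division \<Rightarrow> ('x, 'k::field) mpoly state \<Rightarrow> bool" where
  "state_inv M (Auto P T) \<longleftrightarrow>
     finite P \<and> 0 \<notin> P \<and> T \<subseteq> P \<and> (\<forall>p\<in>P - T. irreducible_in M P p)"
| "state_inv M (Auto_Rem P T p f r) \<longleftrightarrow>
     finite P \<and> 0 \<notin> P \<and> T \<subseteq> P \<and> (\<forall>p\<in>P - T. irreducible_in M P p) \<and>
     p \<in> T \<and> rem_inv M P (P - {p}) p f r"
| "state_inv M (Prolong F S) \<longleftrightarrow>
     finite F \<and> 0 \<notin> F \<and> inj_on (lm lt) F \<and> S \<subseteq> prolongations lt M F \<and>
     (\<forall>t\<in>prolongations lt M F - S. lm lt t \<in> cones M (lm lt ` F))"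
| "state_inv M (Prolong_Rem F S f r) \<longleftrightarrow>
     finite F \<and> 0 \<notin> F \<and> inj_on (lm lt) F \<and>
     (\<exists>s. insert s S \<subseteq> prolongations lt M F \<and> rem_inv M F F s f r \<and>
        (\<forall>t\<in>prolongations lt M F - insert s S. lm lt t \<in> cones M (lm lt ` F)) \<and>
        (\<forall>t\<in>prolongations lt M F. lt (lm lt t) (lm lt s) \<longrightarrow> lm lt t \<in> cones M (lm lt ` F)))"
| "state_inv M (Output F) \<longleftrightarrow> True"

text \<open>
  The leading monomials enter the rank only once they are pairwise distinct: from then on stability
  prevents \<open>Autoreduce\<close> from changing them.
\<close>

definition lead_rank :: "('x, 'k::field) mpoly set \<Rightarrow> nat \<times> 'x mon set" where
  "lead_rank P = (if inj_on (lm lt) P then (0, lm lt ` P) else (1, {}))"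

text \<open>The components are leading monomials, phase, supports, pending work and current
  polynomial. Doubling the count leaves room for the start and the end of each item to decrease it:
  an element under test is still in \<open>T\<close>, hence \<open>- 1\<close>, whereas a selected
  prolongation has left \<open>S\<close>, hence \<open>+ 1\<close>.\<close>

fun state_rank :: "('x, 'k::field) mpoly state \<Rightarrow>
    (nat \<times> 'x mon set) \<times> nat \<times> 'x mon multiset multiset \<times> nat \<times> 'x mon multiset" where
  "state_rank (Auto P T) = (lead_rank P, 2, keys_mset_set P, 2 * card T, {#})"
| "state_rank (Auto_Rem P T p f r) = (lead_rank P, 2, keys_mset_set P, 2 * card T - 1, keys_mset f)"
| "state_rank (Prolong F S) = (lead_rank F, 1, {#}, 2 * card S, {#})"
| "state_rank (Prolong_Rem F S f r) = (lead_rank F, 1, {#}, 2 * card S + 1, keys_mset f)"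
| "state_rank (Output F) = (lead_rank F, 0, {#}, 0, {#})"

abbreviation progress_rel where
  "progress_rel M \<equiv> (less_than <*lex*> lead_rel M) <*lex*> less_than <*lex*> mult (mult mon_rel) <*lex*>
     less_than <*lex*> mult mon_rel"

text \<open>Only a nonzero remainder of a prolongation moves back to an earlier phase, and it pays
  for this by extending the set of leading monomials.\<close>

lemma ib_step_progress:
  fixes a b :: "('x, 'k::field) mpoly state"
  assumes M: "involutive_division M" "continuous_division M" "stable_division M"
    and step: "ib_step lt M a b" and inv: "state_inv M a"
  shows "state_inv M b \<and> (state_rank b, state_rank a) \<in> progress_rel M"
  using step
proof cases
  case (auto_test p T P)
  have "finite T" "T \<noteq> {}" using inv auto_test finite_subset by auto
  then have "card T > 0" by (simp add: card_gt_0_iff)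
  then show ?thesis using inv auto_test by (simp add: rem_inv_start)
next
  case (auto_rem P p f r f' r' T)
  have p: "0 \<notin> P - {p}" using inv auto_rem by simp
  show ?thesis
    using inv auto_rem rem_inv_step[OF auto_rem(3) p, of p] keys_mset_rem_step[OF auto_rem(3) p] by simp
next
  case (auto_unchanged P T p)
  have ri: "rem_inv M P (P - {p}) p 0 p" and T: "p \<in> T" "finite T"
    using inv auto_unchanged finite_subset by auto
  then have "irreducible_in M P p"
    unfolding irreducible_in_def rem_inv_def by blast
  moreover have "card T > 0" using T card_gt_0_iff by blast
  ultimately show ?thesis
    using inv auto_unchanged T by auto
next
  case (auto_changed r p P' P T)
  have P: "finite P" "0 \<notin> P" "p \<in> P" and ri: "rem_inv M P (P - {p}) p 0 r"
    using inv auto_changed by auto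
  have "finite P'" "0 \<notin> P'" using P auto_changed(4) by auto
  then have "state_inv M b" using auto_changed(2) by simp
  moreover have "(keys_mset_set P', keys_mset_set P) \<in> mult (mult mon_rel)"
    using autoreduce_change[OF P(1,3) ri auto_changed(3,4)] .
  \<comment> \<open>If leading monomials are distinct they stay the same; otherwise the rank stays
    at \<open>(1, {})\<close> or its first entry drops to 0.\<close>
  moreover have "lead_rank P' = lead_rank P \<or> (lead_rank P', lead_rank P) \<in> less_than <*lex*> lead_rel M"
    using autoreduce_change_lm[OF M(1,3) P(1,2) _ P(3) ri auto_changed(4)]
    by (auto simp: lead_rank_def)
  ultimately show ?thesis using auto_changed(1,2) by auto
next
  case (auto_done F)
  have "inj_on (lm lt) F"
    using inv auto_done by (intro inj_on_lm_irreducible) auto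
  then show ?thesis using inv auto_done by simp
next
  case (prolong_select s S F)
  have S: "S \<subseteq> prolongations lt M F" "finite F" using inv prolong_select by auto
  have "card S > 0"
    using prolong_select(3) finite_subset[OF S(1) finite_prolongations[OF S(2)]] card_gt_0_iff by blast
  \<comment> \<open>By minimality of \<open>s\<close> such a \<open>t\<close> is no longer in
    \<open>S\<close>, so it has already been processed.\<close>
  moreover have "lm lt t \<in> cones M (lm lt ` F)"
    if "t \<in> prolongations lt M F" "lt (lm lt t) (lm lt s)" for t
    using inv prolong_select that by auto
  moreover have "insert s (S - {s}) = S" using prolong_select(3) by blast
  moreover have "card (S - {s}) = card S - 1" using prolong_select(3) by simp
  ultimately show ?thesis using inv prolong_select(1,2) rem_inv_start
    by (auto intro!: exI[of _ s])
next
  case (prolong_rem F f r f' r' S)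
  have F: "0 \<notin> F" using inv prolong_rem by simp
  obtain s where s: "insert s S \<subseteq> prolongations lt M F" "rem_inv M F F s f r"
        "\<forall>t\<in>prolongations lt M F - insert s S. lm lt t \<in> cones M (lm lt ` F)"
        "\<forall>t\<in>prolongations lt M F. lt (lm lt t) (lm lt s) \<longrightarrow> lm lt t \<in> cones M (lm lt ` F)"
    using inv prolong_rem(1) by auto
  then have "state_inv M b"
    using inv prolong_rem(1,2) rem_inv_step[OF prolong_rem(3) F s(2)] by (simp, intro exI[of _ s]) simp
  then show ?thesis using prolong_rem(1,2) keys_mset_rem_step[OF prolong_rem(3) F] by simp
next
  case (prolong_zero F S)
  obtain s where s: "insert s S \<subseteq> prolongations lt M F" "rem_inv M F F s 0 0"
        "\<forall>t\<in>prolongations lt M F - insert s S. lm lt t \<in> cones M (lm lt ` F)"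
    using inv prolong_zero(1) by auto
  have F: "0 \<notin> F" using inv prolong_zero by simp
  have "s \<noteq> 0" using prolongations_props[OF F, of s M] s(1) by auto
  \<comment> \<open>The zero remainder lets \<open>s\<close> join the processed
    prolongations.\<close>
  then have "lm lt s \<in> cones M (lm lt ` F)"
    using rem_inv_zero[OF s(2)] unfolding reducible_self_iff by simp
  then have "state_inv M b" using inv prolong_zero s by auto
  then show ?thesis using prolong_zero by simp
next
  case (prolong_nonzero r F S)
  obtain s where s: "insert s S \<subseteq> prolongations lt M F" "rem_inv M F F s 0 r"
        "\<forall>t\<in>prolongations lt M F. lt (lm lt t) (lm lt s) \<longrightarrow> lm lt t \<in> cones M (lm lt ` F)"
    using inv prolong_nonzero(1) by auto
  have F: "finite F" "0 \<notin> F" "inj_on (lm lt) F" using inv prolong_nonzero(1) by auto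
  have ext: "lead_ext M (lm lt ` F) (lm lt r)"
    by (rule lead_ext_remainder[OF M(2) F(1,2) _ s(2) prolong_nonzero(3)]) (use s in auto)
  then have "lm lt r \<notin> lm lt ` F"
    unfolding lead_ext_def cones_iff using idvd_refl by blast
  then have "inj_on (lm lt) (insert r F)" using F(3) by auto
  then have "(lead_rank (insert r F), lead_rank F) \<in> less_than <*lex*> lead_rel M"
    using F(1,3) ext unfolding lead_rank_def by auto
  then show ?thesis using F prolong_nonzero by auto
next
  case (prolong_done F)
  then show ?thesis by simp
qed

lemma wf_progress_rel:
  assumes "involutive_division M" "continuous_division M" "constructive_division M"
    "noetherian_division TYPE('k::field) M"
  shows "wf (progress_rel M)"
  by (intro wf_lex_prod wf_less_than wf_mult wf_mon_rel wf_lead_rel[OF assms])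

section \<open>Absence of deadlock and termination\<close>

lemma rem_step_exists:
  fixes f :: "('x, 'k::field) mpoly"
  assumes "f \<noteq> 0"
  shows "\<exists>f' r'. rem_step lt M P C (f, r) (f', r')"
proof (cases "\<exists>p\<in>C. idvd M (lm lt ` P) (lm lt p) (lm lt f)")
  case True
  then show ?thesis using rem_step.reduce[OF assms] by blast
next
  case False
  then show ?thesis using rem_step.move[OF assms] by blast
qed

text \<open>The selection of a prolongation needs a minimal leading monomial, which well-foundedness
  provides; the other phases split on whether their current work is exhausted.\<close>

lemma ib_step_exists:
  fixes b :: "('x, 'k::field) mpoly state"
  assumes "state_inv M b" "\<And>G. b \<noteq> Output G"
  shows "\<exists>c. ib_step lt M b c"
proof (cases b)
  case (Auto P T)
  show ?thesis
  proof (cases "T = {}")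
    case True
    then show ?thesis using Auto ib_step.auto_done by blast
  next
    case False
    then show ?thesis using Auto ib_step.auto_test by blast
  qed
next
  case (Auto_Rem P T p f r)
  show ?thesis
  proof (cases "f = 0")
    case True
    then show ?thesis
      using Auto_Rem ib_step.auto_unchanged[of lt M P T p] ib_step.auto_changed[of r p _ P lt M T]
      by (cases "r = p") blast+
  next
    case False
    then obtain f' r' where "rem_step lt M P (P - {p}) (f, r) (f', r')"
      using rem_step_exists by blast
    then show ?thesis using Auto_Rem ib_step.auto_rem by blast
  qed
next
  case (Prolong F S)
  show ?thesis
  proof (cases "S = {}")
    case True
    then show ?thesis using Prolong ib_step.prolong_done by blast
  next
    case False
    have "finite S" using assms(1) Prolong finite_subset finite_prolongations by auto
    then have "(lm lt ` S) \<noteq> {}" using False by simp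
    then obtain m where "m \<in> lm lt ` S" "\<And>n. (n, m) \<in> mon_rel \<Longrightarrow> n \<notin> lm lt ` S"
      using wfE_min'[OF wf_mon_rel] by metis
    then obtain s where "s \<in> S" "\<forall>t\<in>S. \<not> lt (lm lt t) (lm lt s)" by auto
    then show ?thesis using Prolong ib_step.prolong_select by blast
  qed
next
  case (Prolong_Rem F S f r)
  show ?thesis
  proof (cases "f = 0")
    case True
    then show ?thesis
      using Prolong_Rem ib_step.prolong_zero[of lt M F S] ib_step.prolong_nonzero[of r lt M F S]
      by (cases "r = 0") blast+
  next
    case False
    then obtain f' r' where "rem_step lt M F F (f, r) (f', r')"
      using rem_step_exists by blast
    then show ?thesis using Prolong_Rem ib_step.prolong_rem by blast
  qed
next
  case (Output F)
  then show ?thesis using assms(2) by simp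
qed

text \<open>The ranks along an infinite run would descend forever, and a reachable state without
  successor can only be an output.\<close>

theorem ib_terminates:
  fixes F :: "('x, 'k::field) mpoly set"
  assumes M: "involutive_division M" "continuous_division M" "constructive_division M"
    "noetherian_division TYPE('k) M" "stable_division M"
    and F: "finite F" "0 \<notin> F"
  shows "ib_terminates lt M F"
  unfolding ib_terminates_def always_terminates_def
proof (intro conjI notI allI impI)
  have start: "state_inv M (Auto F F)" using F by simp
  note step = ib_step_progress[OF M(1,2,5)]
  assume "\<exists>run. run 0 = Auto F F \<and> (\<forall>i. ib_step lt M (run i) (run (Suc i)))"
  then obtain run where run: "run 0 = Auto F F" "\<And>i. ib_step lt M (run i) (run (Suc i))" by blast
  have inv: "state_inv M (run i)" for i
    by (induction i) (use run(1) start step[OF run(2)] in simp_all)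
  have "(state_rank (run (Suc i)), state_rank (run i)) \<in> progress_rel M" for i
    using step[OF run(2) inv] by (rule conjunct2)
  then show False
    using wf_no_infinite_down_chainE[OF wf_progress_rel[OF M(1-4)], of "\<lambda>i. state_rank (run i)"] by blast
next
  fix b assume b: "(ib_step lt M)\<^sup>*\<^sup>* (Auto F F) b \<and> \<not> (\<exists>c. ib_step lt M b c)"
  then have "(ib_step lt M)\<^sup>*\<^sup>* (Auto F F) b" by simp
  then have "state_inv M b"
  proof induction
    case base
    show ?case using F by simp
  next
    case (step y z)
    show ?case using ib_step_progress[OF M(1,2,5) step(2,3)] by simp
  qed
  then show "\<exists>G. b = Output G" using ib_step_exists b by blast
qed

end

theorem proposition4p4p8:
  fixes lt :: "('x::finite \<Rightarrow>\<^sub>0 nat) \<Rightarrow> ('x \<Rightarrow>\<^sub>0 nat) \<Rightarrow> bool"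
    and M :: "'x division"
    and F :: "('x, 'k::field) mpoly set"
  assumes "admissible lt"
    and "involutive_division M"
    and "continuous_division M"
    and "constructive_division M"
    and "noetherian_division TYPE('k) M"
    and "stable_division M"
    and "finite F"
    and "0 \<notin> F"
  shows "ib_terminates lt M F"
proof -
  interpret monomial_order lt using assms(1) by unfold_locales
  show ?thesis using assms(2-8) by (rule ib_terminates)
qed

end
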